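(* Let $X$ be a (real or complex) Banach space with a Schauder basis $(x_n)_{n\ge1}$. Assume that the positive matrices $A_k=(a_{ij}^k)_{i,j\ge1}$, $k\in\{1,\dots,N\}$ (i.e. $a_{ij}^k\ge0$ for all $i,j,k$), define continuous operators on $X$ which, as an $N$-tuple, are joint locally quasinilpotent at a nonzero positive vector. If continuous operators $T_k:X\to X$, $k\in\{1,\dots,N\}$, are defined by matrices $(t_{ij}^k)_{i,j\ge1}$ satisfying $t_{ij}^k=0$ whenever $a_{ij}^k=0$, then the operators $T_1,\dots,T_N$ have a common nontrivial closed invariant subspace.
   Context: A Schauder basis $(x_n)_{n\ge1}$ is an infinite sequence, so $X$ is infinite-dimensional. Let $C=\{\sum_{j=1}^\infty t_jx_j\in X: t_j\ge0 \text{ for all } j\}$ be the cone generated by the basis; a vector is positive if it belongs to $C$. An infinite matrix $(m_{ij})_{i,j\ge1}$ of scalars defines a continuous operator $S$ on $X$ if $S:X\to X$ is a continuous linear operator with $Sx_j=\sum_{i=1}^\infty m_{ij}x_i$ (norm-convergent) for every $j$. A tuple $(S_1,\dots,S_N)$ of continuous linear operators on $X$ (not necessarily commuting) is joint locally quasinilpotent at $x_0\in X$ if for every sequence $(i_j)_{j\ge1}$ with $i_j\in\{1,\dots,N\}$, $$\lim_{n\to\infty}\|S_{i_1}S_{i_2}\cdots S_{i_n}x_0\|^{1/n}=0.$$ A common nontrivial closed invariant subspace for $T_1,\dots,T_N$ is a closed linear subspace $M\subset X$ with $M\neq\{0\}$, $M\ne X$ and $T_k(M)\subset M$ for all $k\in\{1,\dots,N\}$.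 *)

theory Defs
  imports "HOL-Analysis.Analysis" "HOL-Library.Nonpos_Ints"
begin

text \<open>
  Real and complex Banach spaces are treated uniformly: the scalar type \<open>'k\<close> is a complete real
  normed field. By the Gelfand-Mazur theorem these are exactly \<open>\<real>\<close> and \<open>\<complex>\<close> (the norm being
  multiplicative), so nothing beyond the real and the complex case is covered. Addition, norm,
  topology and completeness of the space come from its type, of class \<open>banach\<close>; for complex
  scalars \<open>smul\<close> is the complex scalar multiplication, extending the real one.
\<close>

locale normed_space_over = vector_space smul
  for smul :: "'k::{real_normed_field,banach} \<Rightarrow> 'a::real_normed_vector \<Rightarrow> 'a" +
  assumes norm_smul: "norm (smul c v) = norm c * norm v"
    and smul_of_real: "smul (of_real r) v = r *\<^sub>R v"

lemma normed_space_over_scaleR: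
  "normed_space_over (scaleR :: real \<Rightarrow> 'a::real_normed_vector \<Rightarrow> 'a)"
  unfolding normed_space_over_def normed_space_over_axioms_def
  by (simp add: real_vector.vector_space_axioms)

lemma normed_space_over_times_complex: "normed_space_over ((*) :: complex \<Rightarrow> complex \<Rightarrow> complex)"
  unfolding normed_space_over_def normed_space_over_axioms_def vector_space_def
  by (simp add: algebra_simps norm_mult scaleR_conv_of_real)

text \<open>Sequences, matrices and words are indexed from 0.\<close>

definition schauder_basis ::
  "('k::{real_normed_field,banach} \<Rightarrow> 'a::real_normed_vector \<Rightarrow> 'a) \<Rightarrow> (nat \<Rightarrow> 'a) \<Rightarrow> bool" where
  "schauder_basis smul x \<longleftrightarrow> (\<forall>v. \<exists>!t. (\<lambda>j. smul (t j) (x j)) sums v)"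

definition basis_cone ::
  "('k::{real_normed_field,banach} \<Rightarrow> 'a::real_normed_vector \<Rightarrow> 'a) \<Rightarrow> (nat \<Rightarrow> 'a) \<Rightarrow> 'a set" where
  "basis_cone smul x =
    {v. \<exists>t. (\<forall>j. t j \<in> \<real>\<^sub>\<ge>\<^sub>0) \<and> (\<lambda>j. smul (t j) (x j)) sums v}"

definition continuous_operator ::
  "('k::{real_normed_field,banach} \<Rightarrow> 'a::real_normed_vector \<Rightarrow> 'a) \<Rightarrow> ('a \<Rightarrow> 'a) \<Rightarrow> bool" where
  "continuous_operator smul S \<longleftrightarrow> Vector_Spaces.linear smul smul S \<and> continuous_on UNIV S"

definition defines_operator ::
  "('k::{real_normed_field,banach} \<Rightarrow> 'a::real_normed_vector \<Rightarrow> 'a) \<Rightarrow> (nat \<Rightarrow> 'a) \<Rightarrow>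
    (nat \<Rightarrow> nat \<Rightarrow> 'k) \<Rightarrow> ('a \<Rightarrow> 'a) \<Rightarrow> bool" where
  "defines_operator smul x m S \<longleftrightarrow>
    continuous_operator smul S \<and> (\<forall>j. (\<lambda>i. smul (m i j) (x i)) sums S (x j))"

text \<open>
  The \<open>foldr\<close> term is \<open>S (w 0) (S (w 1) (\<dots> (S (w (n - 1)) v)))\<close>. Its \<open>0\<close>-th root at \<open>n = 0\<close> is
  irrelevant for the limit.
\<close>

definition joint_locally_quasinilpotent_at ::
  "nat \<Rightarrow> (nat \<Rightarrow> 'a::real_normed_vector \<Rightarrow> 'a) \<Rightarrow> 'a \<Rightarrow> bool" where
  "joint_locally_quasinilpotent_at N S v \<longleftrightarrow>
    (\<forall>w :: nat \<Rightarrow> nat. (\<forall>j. w j \<in> {1..N}) \<longrightarrow>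
      (\<lambda>n. root n (norm (foldr (\<lambda>j. S (w j)) [0..<n] v))) \<longlonglongrightarrow> 0)"

definition common_nontrivial_closed_invariant_subspace ::
  "('k::{real_normed_field,banach} \<Rightarrow> 'a::real_normed_vector \<Rightarrow> 'a) \<Rightarrow>
    nat \<Rightarrow> (nat \<Rightarrow> 'a \<Rightarrow> 'a) \<Rightarrow> 'a set \<Rightarrow> bool" where
  "common_nontrivial_closed_invariant_subspace smul N T M \<longleftrightarrow>
    module.subspace smul M \<and> closed M \<and> M \<noteq> {0} \<and> M \<noteq> UNIV \<and> (\<forall>k\<in>{1..N}. T k ` M \<subseteq> M)"

end

theory Submission imports Defs
begin

text \<open>
  Regard the matrices \<open>a k\<close> as a directed graph on the indices, with an edge from \<open>j\<close> to \<open>i\<close> when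
  some \<open>a k i j\<close> is nonzero. If \<open>R\<close> is a set of indices that no edge leaves, then the vectors whose
  coordinates vanish outside \<open>R\<close> form a subspace that every \<open>T k\<close> maps into itself, because the
  matrix of \<open>T k\<close> has nonzero entries only on edges (\<open>support_subspace_invariant\<close>). So it is enough
  to find two indices one of which cannot be reached from the other: take \<open>R\<close> to be everything
  reachable from the latter.

  Such a pair exists because a closed path through an index \<open>l\<close> in the support of the
  quasinilpotence vector \<open>v\<close> is impossible (\<open>no_cycle_through_support\<close>). Going round the path
  multiplies the \<open>l\<close>-th coordinate of a positive vector by at least a constant \<open>c > 0\<close>, the product
  of the entries along the path; no cancellation can occur between nonnegative terms. Repeating
  the path periodically gives a word along which the \<open>n\<close>-th roots of the norms do not tend to 0,
  against joint local quasinilpotence at \<open>v\<close>. Hence, of the indices \<open>l\<close> and \<open>Suc l\<close>, at least one is not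
  reachable from the other.

  Both halves rest on the continuity of the coordinate functionals of a Schauder basis
  (\<open>bounded_linear_coord\<close>): it makes the subspaces closed, lets a matrix act on coordinates by an
  infinite sum, and turns lower bounds on coordinates into lower bounds on norms. It is proved by
  the argument of the open mapping theorem, applied to the identity from the space with norm
  \<open>sup n. norm (proj n y)\<close> to the space with its own norm.
\<close>

section \<open>Series of nonnegative scalars and periodic words\<close>

text \<open>
  The scalar field carries no order, so positivity is expressed through norms: on nonnegative reals
  \<open>of_real\<close> is inverse to the norm, which reduces the claim to real series.
\<close>

lemma nonneg_Reals_sums:
  fixes u :: "nat \<Rightarrow> 'b::real_normed_algebra_1"
  assumes u: "\<And>j. u j \<in> \<real>\<^sub>\<ge>\<^sub>0" and "u sums s"
  shows "s \<in> \<real>\<^sub>\<ge>\<^sub>0" and "norm (u j) \<le> norm s"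
proof -
  have u_eq: "u j = of_real (norm (u j))" for j
    using u[of j] by (auto simp: nonneg_Reals_def)
  have sum_eq: "(\<Sum>j<n. u j) = of_real (\<Sum>j<n. norm (u j))" for n
    unfolding of_real_sum by (rule sum.cong[OF refl u_eq])
  have "norm (\<Sum>j<n. u j) = (\<Sum>j<n. norm (u j))" for n
    unfolding sum_eq by (simp add: sum_nonneg del: of_real_sum)
  then have norm_sums: "(\<lambda>j. norm (u j)) sums norm s"
    using tendsto_norm[OF \<open>u sums s\<close>[unfolded sums_def]] by (simp add: sums_def)
  then have "u sums of_real (norm s)"
    using sums_of_real[OF norm_sums, where ?'a = 'b] by (simp flip: u_eq)
  then have "s = of_real (norm s)" using \<open>u sums s\<close> sums_unique2 by blast
  then show "s \<in> \<real>\<^sub>\<ge>\<^sub>0" by (metis nonneg_Reals_of_real_iff norm_ge_zero)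
  show "norm (u j) \<le> norm s"
    using sum_le_suminf[of "\<lambda>j. norm (u j)" "{j}"] norm_sums by (simp add: sums_iff)
qed

lemma foldr_periodic:
  assumes "length ks = p" and "\<And>j. f j = g (ks ! (j mod p))"
  shows "foldr f [0..<q * p] v = (foldr g ks ^^ q) v"
proof (induction q)
  case (Suc q)
  have "[0..<Suc q * p] = [0..<p] @ map (\<lambda>j. j + p) [0..<q * p]"
    using upt_add_eq_append[of 0 p "q * p"] map_add_upt[of p "q * p"] by (simp add: add.commute[of _ p])
  moreover have "map f [0..<p] = map g ks"
    using assms by (intro nth_equalityI) auto
  then have "foldr id (map f [0..<p]) = foldr id (map g ks)" by simp
  then have "foldr f [0..<p] = foldr g ks" by (simp add: fun_eq_iff foldr_map)
  moreover have "foldr f (map (\<lambda>j. j + p) [0..<q * p]) v = foldr f [0..<q * p] v"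
    using assms(2)[abs_def] by (simp add: foldr_map o_def)
  ultimately show ?case using Suc by simp
qed simp

section \<open>Coordinate functionals of a Schauder basis\<close>

lemma (in normed_space_over) bounded_bilinear_smul: "bounded_bilinear smul"
proof
  show "\<exists>K. \<forall>a b. norm (smul a b) \<le> norm a * norm b * K"
    by (rule exI[of _ 1]) (simp add: norm_smul)
  show "smul (r *\<^sub>R a) b = r *\<^sub>R smul a b" for r a b
    by (simp add: scaleR_conv_of_real smul_of_real flip: scale_scale)
  show "smul a (r *\<^sub>R b) = r *\<^sub>R smul a b" for r a b
    by (metis scale_left_commute smul_of_real)
qed (simp_all add: scale_left_distrib scale_right_distrib)

locale schauder_space = normed_space_over smul
  for smul :: "'k::{real_normed_field,banach} \<Rightarrow> 'a::banach \<Rightarrow> 'a" +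
  fixes x :: "nat \<Rightarrow> 'a"
  assumes basis: "schauder_basis smul x"
begin

sublocale smul: bounded_bilinear smul
  by (rule bounded_bilinear_smul)

definition coord :: "'a \<Rightarrow> nat \<Rightarrow> 'k" where
  "coord y = (THE t. (\<lambda>j. smul (t j) (x j)) sums y)"

definition proj :: "nat \<Rightarrow> 'a \<Rightarrow> 'a" where
  "proj n y = (\<Sum>j<n. smul (coord y j) (x j))"

lemma coord_sums: "(\<lambda>j. smul (coord y j) (x j)) sums y"
  using theI'[of "\<lambda>t. (\<lambda>j. smul (t j) (x j)) sums y"] basis
  unfolding schauder_basis_def coord_def by blast

lemma coord_eqI: "(\<lambda>j. smul (t j) (x j)) sums y \<Longrightarrow> coord y = t"
  using basis coord_sums unfolding schauder_basis_def by blast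

lemma coord_add: "coord (y + z) j = coord y j + coord z j"
proof -
  have "coord (y + z) = (\<lambda>j. coord y j + coord z j)"
    by (rule coord_eqI) (simp add: scale_left_distrib sums_add coord_sums)
  then show ?thesis by simp
qed

lemma coord_smul: "coord (smul c y) j = c * coord y j"
proof -
  have "coord (smul c y) = (\<lambda>j. c * coord y j)"
    using bounded_linear.sums[OF smul.bounded_linear_right coord_sums] by (intro coord_eqI) (simp flip: scale_scale)
  then show ?thesis by simp
qed

lemma coord_scaleR: "coord (r *\<^sub>R y) j = r *\<^sub>R coord y j"
  by (metis coord_smul scaleR_conv_of_real smul_of_real)

lemma coord_diff: "coord (y - z) j = coord y j - coord z j"
  using coord_add[of "y - z" z j] by simp

lemma coord_zero: "coord 0 j = 0"
  using coord_scaleR[of 0 0 j] by simp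

lemma coord_basis: "coord (x i) j = (if j = i then 1 else 0)"
proof -
  have "(\<lambda>j. if j = i then x j else 0) sums x i"
    by (rule sums_single)
  also have "(\<lambda>j. if j = i then x j else 0) = (\<lambda>j. smul (if j = i then 1 else 0) (x j))"
    by auto
  finally show ?thesis by (simp add: coord_eqI)
qed

lemma basis_nonzero: "x i \<noteq> 0"
  using coord_basis[of i i] coord_zero[of i] by auto

lemma proj_diff: "proj n (y - z) = proj n y - proj n z"
  by (simp add: proj_def coord_diff scale_left_diff_distrib sum_subtractf)

lemma proj_scaleR: "proj n (r *\<^sub>R y) = r *\<^sub>R proj n y"
  by (simp add: proj_def coord_scaleR smul.scaleR_left scaleR_sum_right)

lemma proj_zero: "proj n 0 = 0"
  by (simp add: proj_def coord_zero)

lemma proj_tendsto: "(\<lambda>n. proj n y) \<longlonglongrightarrow> y"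
  using coord_sums unfolding sums_def proj_def .

lemma proj_bounded: "\<exists>m::nat. \<forall>n. norm (proj n y) \<le> real m"
proof -
  have "Bseq (\<lambda>n. proj n y)"
    using proj_tendsto convergentI convergent_imp_Bseq by blast
  then obtain K where "\<forall>n. norm (proj n y) \<le> K" unfolding Bseq_def by blast
  moreover obtain m :: nat where "K \<le> real m" using real_arch_simple by blast
  ultimately show ?thesis by (meson order_trans)
qed

text \<open>One term of the expansion is the difference of two consecutive partial sums.\<close>

lemma norm_coord_basis_le:
  assumes "\<And>n. norm (proj n y) \<le> B"
  shows "norm (coord y j) * norm (x j) \<le> 2 * B"
proof -
  have "smul (coord y j) (x j) = proj (Suc j) y - proj j y" by (simp add: proj_def)
  then have "norm (smul (coord y j) (x j)) \<le> norm (proj (Suc j) y) + norm (proj j y)"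
    by (simp add: norm_triangle_ineq4)
  with assms[of j] assms[of "Suc j"] show ?thesis by (simp add: norm_smul)
qed

text \<open>
  The category step. The sets \<open>K m\<close> of vectors whose partial sums are bounded by \<open>m\<close> cover the
  space, so one of them is dense in a ball \<open>ball z r\<close>. Differences of two approximants, one for the
  centre and one for a point of the ball, move the ball to the origin, and scaling reaches all of
  the space. The approximation is arbitrarily good while the bound depends on \<open>u\<close> only.
\<close>

lemma approx_with_bounded_projections:
  obtains D where "D \<ge> 0"
    "\<And>u e. e > 0 \<Longrightarrow> \<exists>k. (\<forall>n. norm (proj n k) \<le> D * norm u) \<and> norm (u - k) < e"
proof -
  define K where "K m = {y. \<forall>n. norm (proj n y) \<le> real m}" for m :: nat
  have "\<exists>m. interior (closure (K m)) \<noteq> {}"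
  proof (rule ccontr)
    assume "\<not> ?thesis"
    then have "euclidean interior_of \<Union>(range (\<lambda>m. closure (K m))) = {}"
      by (intro Baire_category_alt) (auto simp: completely_metrizable_space_euclidean)
    moreover have "(\<Union>m. closure (K m)) = UNIV"
    proof -
      have "y \<in> (\<Union>m. closure (K m))" for y
      proof -
        obtain m where "y \<in> K m" using proj_bounded[of y] by (auto simp: K_def)
        then have "y \<in> closure (K m)" by (rule subsetD[OF closure_subset])
        then show ?thesis by blast
      qed
      then show ?thesis by blast
    qed
    ultimately show False by simp
  qed
  then obtain m z where "z \<in> interior (closure (K m))" by auto
  then obtain r where r: "r > 0" "ball z r \<subseteq> closure (K m)"
    unfolding mem_interior by blast
  define D where "D = 4 * real m / r"
  show thesis
  proof
    show "D \<ge> 0" using r by (simp add: D_def)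
    fix u :: 'a and e :: real
    assume e: "e > 0"
    show "\<exists>k. (\<forall>n. norm (proj n k) \<le> D * norm u) \<and> norm (u - k) < e"
    proof (cases "u = 0")
      case True
      then show ?thesis using e by (intro exI[of _ 0]) (simp add: proj_zero)
    next
      case False
      define s where "s = r / (2 * norm u)"
      have s: "s > 0" using r False by (simp add: s_def)
      have "z \<in> closure (K m)" "z + s *\<^sub>R u \<in> closure (K m)"
        using r False by (auto intro!: subsetD[OF r(2)] simp: dist_norm s_def)
      moreover have "s * e / 2 > 0" using s e by simp
      ultimately obtain p q where p: "p \<in> K m" "dist p (z + s *\<^sub>R u) < s * e / 2"
          and q: "q \<in> K m" "dist q z < s * e / 2"
        unfolding closure_approachable by meson
      define k where "k = (p - q) /\<^sub>R s"
      have "norm (proj n k) \<le> D * norm u" for n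
      proof -
        have "norm (proj n p - proj n q) \<le> norm (proj n p) + norm (proj n q)"
          by (rule norm_triangle_ineq4)
        also have "\<dots> \<le> 2 * real m"
          using p(1) q(1) unfolding K_def by (smt (verit, best) mem_Collect_eq)
        finally have "norm (proj n k) \<le> 2 * real m / s"
          using s by (simp add: k_def proj_scaleR proj_diff divide_simps mult.commute)
        also have "\<dots> = D * norm u" using r False by (simp add: s_def D_def field_simps)
        finally show ?thesis .
      qed
      moreover have "norm (u - k) < e"
      proof -
        have "s *\<^sub>R (u - k) = (z + s *\<^sub>R u - p) - (z - q)"
          using s by (simp add: k_def algebra_simps)
        then have "norm (s *\<^sub>R (u - k)) \<le> norm (z + s *\<^sub>R u - p) + norm (z - q)"
          by (metis norm_triangle_ineq4)
        also have "\<dots> < s * e / 2 + s * e / 2"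
          using p(2) q(2) by (intro add_strict_mono) (simp_all add: dist_norm norm_minus_commute)
        finally show ?thesis using s by simp
      qed
      ultimately show ?thesis by blast
    qed
  qed
qed

text \<open>
  Applying the approximation to the successive residuals writes \<open>y\<close> as a series of vectors \<open>k i\<close>
  whose partial sums are bounded by the geometric sequence \<open>M\<close>. What remains is that the expansion
  of \<open>y\<close> is the sum of the expansions of the \<open>k i\<close>, that is, an interchange of two limits, which
  Tannery's theorem justifies.
\<close>

lemma proj_uniformly_bounded: "\<exists>D. \<forall>n y. norm (proj n y) \<le> D * norm y"
proof -
  obtain D where D: "D \<ge> 0" and
    app: "\<And>u e. e > 0 \<Longrightarrow> \<exists>k. (\<forall>n. norm (proj n k) \<le> D * norm u) \<and> norm (u - k) < e"
    using approx_with_bounded_projections by blast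
  have "\<exists>k. (\<forall>n. norm (proj n k) \<le> D * norm u) \<and> norm (u - k) \<le> norm u / 2" for u
  proof (cases "u = 0")
    case True
    then show ?thesis by (intro exI[of _ 0]) (simp add: proj_zero)
  next
    case False
    then show ?thesis using app[of "norm u / 2" u] by (meson less_imp_le half_gt_zero zero_less_norm_iff)
  qed
  then obtain g where g: "\<And>u n. norm (proj n (g u)) \<le> D * norm u"
      "\<And>u. norm (u - g u) \<le> norm u / 2" by metis
  have "norm (proj n y) \<le> 2 * D * norm y" for n y
  proof -
    define res where "res i = ((\<lambda>u. u - g u) ^^ i) y" for i
    define k where "k i = g (res i)" for i
    define M where "M i = D * norm y * (1/2)^i" for i :: nat
    have res_Suc: "res (Suc i) = res i - k i" for i by (simp add: res_def k_def)
    have res_le: "norm (res i) \<le> norm y * (1/2)^i" for i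
    proof (induction i)
      case (Suc i)
      then show ?case using g(2)[of "res i"] by (simp add: res_def)
    qed (simp add: res_def)
    have M_sums: "M sums (2 * D * norm y)"
      using sums_mult[OF geometric_sums[of "1/2::real"], of "D * norm y"]
      by (simp add: M_def[abs_def] mult_ac)
    have proj_k: "norm (proj n (k i)) \<le> M i" for n i
      using order_trans[OF g(1) mult_left_mono[OF res_le D]] by (simp add: M_def k_def mult.assoc)
    have norm_k: "norm (k i) \<le> M i" for i
      using LIMSEQ_le_const2[OF tendsto_norm[OF proj_tendsto[of "k i"]], of "M i"] proj_k by blast
    have "res \<longlonglongrightarrow> 0"
    proof (rule Lim_null_comparison)
      show "\<forall>\<^sub>F i in sequentially. norm (res i) \<le> norm y * (1/2)^i" by (simp add: res_le)
      show "(\<lambda>i. norm y * (1/2)^i) \<longlonglongrightarrow> 0"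
        by (intro tendsto_mult_right_zero LIMSEQ_power_zero) simp
    qed
    moreover have "(\<Sum>i<n. k i) = y - res n" for n
      by (induction n) (simp_all add: res_Suc, simp add: res_def)
    ultimately have k_sums: "k sums y"
      using tendsto_diff[OF tendsto_const[of y], of res 0] by (simp add: sums_def)

    \<comment> \<open>The candidates for the coordinates of \<open>y\<close>, with partial sums \<open>S\<close>; they turn out to be
      \<open>coord y\<close> by uniqueness of the expansion.\<close>
    define c where "c j = (\<Sum>i. coord (k i) j)" for j
    have c: "(\<lambda>i. coord (k i) j) sums c j" for j
    proof -
      have "norm (coord (k i) j) \<le> 2 / norm (x j) * M i" for i
        using norm_coord_basis_le[of "k i" "M i" j] proj_k basis_nonzero[of j]
        by (simp add: field_simps)
      then have "summable (\<lambda>i. coord (k i) j)"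
        by (rule summable_comparison_test'[OF summable_mult[OF sums_summable[OF M_sums]]])
      then show ?thesis by (simp add: c_def summable_sums)
    qed
    define S where "S n = (\<Sum>j<n. smul (c j) (x j))" for n
    have S_sums: "(\<lambda>i. proj n (k i)) sums S n" for n
      unfolding proj_def S_def by (intro sums_sum bounded_linear.sums[OF smul.bounded_linear_left] c)
    have S_le: "norm (S n) \<le> 2 * D * norm y" for n
      using norm_sums_le[OF S_sums M_sums] proj_k by blast
    \<comment> \<open>The tails of the \<open>k i\<close> add up to \<open>y - S n\<close>, so it is enough to sum their norms.\<close>
    have "(\<lambda>n. \<Sum>i. norm (k i - proj n (k i))) \<longlonglongrightarrow> (\<Sum>i. 0)"
    proof (rule tannerys_theorem[THEN conjunct2, THEN conjunct2])
      show "(\<lambda>n. norm (k i - proj n (k i))) \<longlonglongrightarrow> 0" for i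
        using tendsto_norm[OF tendsto_diff[OF tendsto_const[of "k i"] proj_tendsto[of "k i"]]] by simp
      have "norm (k i - proj n (k i)) \<le> 2 * M i" for i n
        using norm_triangle_ineq4[of "k i" "proj n (k i)"] norm_k[of i] proj_k[of n i] by linarith
      then show "\<forall>\<^sub>F (i, n) in sequentially \<times>\<^sub>F sequentially. norm (norm (k i - proj n (k i))) \<le> 2 * M i"
        by (simp add: case_prod_unfold)
      show "summable (\<lambda>i. 2 * M i)" by (rule summable_mult[OF sums_summable[OF M_sums]])
    qed simp
    moreover have "norm (y - S n) \<le> (\<Sum>i. norm (k i - proj n (k i)))" for n
    proof -
      have "norm (k i - proj n (k i)) \<le> 2 * M i" for i
        using norm_triangle_ineq4[of "k i" "proj n (k i)"] norm_k[of i] proj_k[of n i] by linarith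
      then have "norm (norm (k i - proj n (k i))) \<le> 2 * M i" for i by simp
      then have "summable (\<lambda>i. norm (k i - proj n (k i)))"
        by (rule summable_comparison_test'[OF summable_mult[OF sums_summable[OF M_sums]]])
      from summable_norm[OF this] show ?thesis
        using sums_diff[OF k_sums S_sums] by (simp add: sums_iff)
    qed
    ultimately have "(\<lambda>n. y - S n) \<longlonglongrightarrow> 0"
      by (intro Lim_null_comparison[where f = "\<lambda>n. y - S n"]) auto
    then have "S \<longlonglongrightarrow> y"
      using tendsto_diff[OF tendsto_const[of y]] by fastforce
    then have "coord y = c"
      by (intro coord_eqI) (simp add: sums_def S_def[abs_def])
    then show ?thesis using S_le by (simp add: proj_def S_def)
  qed
  then show ?thesis by blast
qed

theorem bounded_linear_coord: "bounded_linear (\<lambda>y. coord y j)"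
proof -
  obtain D where D: "\<And>n y. norm (proj n y) \<le> D * norm y"
    using proj_uniformly_bounded by blast
  show ?thesis
  proof (rule bounded_linear_intro)
    show "norm (coord y j) \<le> norm y * (2 * D / norm (x j))" for y
      using norm_coord_basis_le[OF D, of y j] basis_nonzero[of j] by (simp add: field_simps)
  qed (simp_all add: coord_add coord_scaleR)
qed

section \<open>Operators given by matrices\<close>

text \<open>
  Only the columns of the matrix are given. The formula for the rows follows by expanding \<open>y\<close> and
  passing to the limit twice, through \<open>S\<close> and through a coordinate functional.
\<close>

lemma defines_operator_coord_sums:
  assumes "defines_operator smul x m S"
  shows "(\<lambda>j. coord y j * m i j) sums coord (S y) i"
proof -
  from assms have lin: "Vector_Spaces.linear smul smul S" and "continuous_on UNIV S"
    and col: "\<And>j. (\<lambda>i. smul (m i j) (x i)) sums S (x j)"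
    by (auto simp: defines_operator_def continuous_operator_def)
  interpret S: Vector_Spaces.linear smul smul S by fact
  have "isCont S y" using \<open>continuous_on UNIV S\<close> by (simp add: continuous_on_eq_continuous_at)
  then have "(\<lambda>n. S (proj n y)) \<longlonglongrightarrow> S y"
    by (rule isCont_tendsto_compose) (rule proj_tendsto)
  then have "(\<lambda>j. smul (coord y j) (S (x j))) sums S y"
    by (simp add: sums_def proj_def S.sum S.scale)
  from bounded_linear.sums[OF bounded_linear_coord[of i] this]
  show ?thesis by (simp add: coord_smul coord_eqI[OF col])
qed


lemma support_subspace_invariant:
  assumes T: "\<And>k. k \<in> {1..N} \<Longrightarrow> defines_operator smul x (t k) (T k)"
    and closed_R: "\<And>k i j. k \<in> {1..N} \<Longrightarrow> t k i j \<noteq> 0 \<Longrightarrow> j \<in> R \<Longrightarrow> i \<in> R"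
    and R: "l \<in> R" "m \<notin> R"
  shows "common_nontrivial_closed_invariant_subspace smul N T {y. \<forall>i. i \<notin> R \<longrightarrow> coord y i = 0}"
    (is "common_nontrivial_closed_invariant_subspace smul N T ?M")
  unfolding common_nontrivial_closed_invariant_subspace_def
proof (intro conjI ballI)
  show "subspace ?M"
    by (rule subspaceI) (simp_all add: coord_zero coord_add coord_smul)
  show "closed ?M"
  proof -
    have "closed {y. coord y i = 0}" for i
      using bounded_linear.continuous_on[OF bounded_linear_coord continuous_on_id, of UNIV i]
      by (intro closed_Collect_eq) auto
    moreover have "?M = (\<Inter>i\<in>-R. {y. coord y i = 0})" by auto
    ultimately show ?thesis by (simp add: closed_INT)
  qed
  have "x l \<in> ?M" using R by (auto simp: coord_basis)
  then show "?M \<noteq> {0}" using basis_nonzero[of l] by blast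
  have "x m \<notin> ?M" using R by (auto simp: coord_basis)
  then show "?M \<noteq> UNIV" by blast
  show "T k ` ?M \<subseteq> ?M" if k: "k \<in> {1..N}" for k
  proof clarsimp
    fix y i
    assume y: "\<forall>i. i \<notin> R \<longrightarrow> coord y i = 0" and i: "i \<notin> R"
    have "(\<lambda>j. coord y j * t k i j) = (\<lambda>_. 0)"
    proof
      show "coord y j * t k i j = 0" for j
        using y closed_R[OF k, of i j] i by (cases "j \<in> R") auto
    qed
    then have "(\<lambda>_. 0) sums coord (T k y) i"
      using defines_operator_coord_sums[OF T[OF k], of y i] by metis
    then show "coord (T k y) i = 0"
      using sums_unique2[OF _ sums_zero] by blast
  qed
qed

section \<open>Positive matrices\<close>

lemma mem_basis_cone_iff: "y \<in> basis_cone smul x \<longleftrightarrow> (\<forall>j. coord y j \<in> \<real>\<^sub>\<ge>\<^sub>0)"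
  unfolding basis_cone_def using coord_eqI coord_sums by blast

text \<open>A sum of nonnegative terms dominates each of them; this is where positivity of the matrix enters.\<close>

lemma positive_operator_on_cone:
  assumes S: "defines_operator smul x m S" and m: "\<And>i j. m i j \<in> \<real>\<^sub>\<ge>\<^sub>0"
    and y: "y \<in> basis_cone smul x"
  shows "S y \<in> basis_cone smul x"
    and "norm (m i j) * norm (coord y j) \<le> norm (coord (S y) i)"
proof -
  have nonneg: "coord y j * m i j \<in> \<real>\<^sub>\<ge>\<^sub>0" for i j
    using y m by (simp add: mem_basis_cone_iff)
  show "S y \<in> basis_cone smul x"
    using nonneg_Reals_sums(1)[OF nonneg defines_operator_coord_sums[OF S]]
    by (simp add: mem_basis_cone_iff)
  show "norm (m i j) * norm (coord y j) \<le> norm (coord (S y) i)"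
    using nonneg_Reals_sums(2)[OF nonneg defines_operator_coord_sums[OF S]]
    by (metis norm_mult mult.commute)
qed

text \<open>
  The labels \<open>ks\<close> of a path multiply to an operator whose \<open>(i, j)\<close> entry is at least the product
  \<open>c\<close> of the entries along the path. Since \<open>foldr\<close> applies the last operator first, a step added
  at the end of the path is put in front of the list.
\<close>

lemma path_lower_bound:
  assumes A: "\<And>k. k \<in> I \<Longrightarrow> defines_operator smul x (a k) (A k)"
    and a: "\<And>k i j. k \<in> I \<Longrightarrow> a k i j \<in> \<real>\<^sub>\<ge>\<^sub>0"
    and path: "(j, i) \<in> {(j, i). \<exists>k\<in>I. a k i j \<noteq> 0}\<^sup>+"
  shows "\<exists>ks c. ks \<noteq> [] \<and> set ks \<subseteq> I \<and> c > 0 \<and>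
    (\<forall>y\<in>basis_cone smul x. foldr A ks y \<in> basis_cone smul x \<and>
      c * norm (coord y j) \<le> norm (coord (foldr A ks y) i))"
  using path
proof (induction rule: trancl_induct)
  case (base i)
  then obtain k where k: "k \<in> I" "a k i j \<noteq> 0" by blast
  with positive_operator_on_cone[OF A[OF k(1)] a[OF k(1)]] show ?case
    by (intro exI[of _ "[k]"] exI[of _ "norm (a k i j)"]) simp
next
  case (step i i')
  then obtain ks c where ks: "set ks \<subseteq> I" "c > 0"
    "\<And>y. y \<in> basis_cone smul x \<Longrightarrow> foldr A ks y \<in> basis_cone smul x \<and>
      c * norm (coord y j) \<le> norm (coord (foldr A ks y) i)" by blast
  from step obtain k where k: "k \<in> I" "a k i' i \<noteq> 0" by blast
  note pos = positive_operator_on_cone[OF A[OF k(1)] a[OF k(1)]]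
  have "norm (a k i' i) * c * norm (coord y j) \<le> norm (coord (A k (foldr A ks y)) i')"
    if y: "y \<in> basis_cone smul x" for y
  proof -
    have "norm (a k i' i) * (c * norm (coord y j)) \<le>
        norm (a k i' i) * norm (coord (foldr A ks y) i)"
      using ks(3)[OF y] by (intro mult_left_mono) auto
    also have "\<dots> \<le> norm (coord (A k (foldr A ks y)) i')"
      using ks(3)[OF y] pos(2) by blast
    finally show ?thesis by (simp add: mult.assoc)
  qed
  then show ?case using ks k pos(1)
    by (intro exI[of _ "k # ks"] exI[of _ "norm (a k i' i) * c"]) simp
qed

text \<open>
  Quasinilpotence is needed along a single word, the periodic repetition of the closed path: at the
  multiples of the period \<open>p\<close> it gives the powers of one positive operator.
\<close>

lemma no_cycle_through_support:
  assumes A: "\<And>k. k \<in> {1..N} \<Longrightarrow> defines_operator smul x (a k) (A k)"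
    and a: "\<And>k i j. k \<in> {1..N} \<Longrightarrow> a k i j \<in> \<real>\<^sub>\<ge>\<^sub>0"
    and v: "v \<in> basis_cone smul x" "coord v l \<noteq> 0"
    and quasinilpotent: "joint_locally_quasinilpotent_at N A v"
  shows "(l, l) \<notin> {(j, i). \<exists>k\<in>{1..N}. a k i j \<noteq> 0}\<^sup>+"
proof
  assume "(l, l) \<in> {(j, i). \<exists>k\<in>{1..N}. a k i j \<noteq> 0}\<^sup>+"
  from path_lower_bound[OF A a this] obtain ks c where ks: "ks \<noteq> []" "set ks \<subseteq> {1..N}"
    and c: "c > 0"
    and step: "\<And>y. y \<in> basis_cone smul x \<Longrightarrow> foldr A ks y \<in> basis_cone smul x \<and>
      c * norm (coord y l) \<le> norm (coord (foldr A ks y) l)"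
    by blast
  define p where "p = length ks"
  have p: "p > 0" using ks by (simp add: p_def)
  define w where "w j = ks ! (j mod p)" for j
  define u where "u n = foldr (\<lambda>j. A (w j)) [0..<n] v" for n
  have w: "w j \<in> {1..N}" for j
    using ks(2) p nth_mem[of "j mod p" ks] unfolding w_def p_def
    by (meson mod_less_divisor subsetD)
  have u_mult: "u (q * p) = (foldr A ks ^^ q) v" for q
    unfolding u_def by (subst foldr_periodic[where p = p and ks = ks]) (auto simp: w_def p_def)
  obtain C where C: "C > 0" "\<And>y. norm (coord y l) \<le> norm y * C"
    using bounded_linear.pos_bounded[OF bounded_linear_coord] by blast
  have lower: "(foldr A ks ^^ q) v \<in> basis_cone smul x \<and>
      c ^ q * norm (coord v l) \<le> norm (coord ((foldr A ks ^^ q) v) l)" for q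
  proof (induction q)
    case (Suc q)
    from Suc have "c * (c ^ q * norm (coord v l)) \<le> c * norm (coord ((foldr A ks ^^ q) v) l)"
      using c by (intro mult_left_mono) auto
    with Suc step[of "(foldr A ks ^^ q) v"] show ?case by (auto simp: mult.assoc)
  qed (use v in simp)
  \<comment> \<open>Because \<open>p \<ge> 1\<close> and \<open>e \<le> 1\<close>, also \<open>e ^ p \<le> c / 2\<close>: a rate below \<open>e\<close> per letter loses against
    the growth \<open>c\<close> per period.\<close>
  define e where "e = min 1 (c / 2)"
  have e: "0 < e" "e \<le> 1" "e \<le> c / 2" using c by (auto simp: e_def)
  have "(\<lambda>n. root n (norm (u n))) \<longlonglongrightarrow> 0"
    using quasinilpotent w unfolding joint_locally_quasinilpotent_at_def u_def by blast
  then have "\<forall>\<^sub>F n in sequentially. root n (norm (u n)) < e"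
    using e(1) by (rule order_tendstoD)
  then obtain n0 where n0: "\<And>n. n \<ge> n0 \<Longrightarrow> root n (norm (u n)) < e"
    unfolding eventually_sequentially by blast
  have "2 ^ q * norm (coord v l) \<le> C" if q: "q \<ge> Suc n0" for q
  proof -
    have "q * 1 \<le> q * p" using p by (intro mult_left_mono) auto
    with q p have n: "q * p \<ge> n0" "q * p > 0" by linarith+
    have "norm (u (q * p)) = root (q * p) (norm (u (q * p))) ^ (q * p)"
      using n by simp
    also have "\<dots> \<le> e ^ (q * p)"
      using n0[OF n(1)] by (intro power_mono) (simp_all add: less_imp_le real_root_ge_zero)
    also have "\<dots> \<le> e ^ q"
      using e \<open>q * 1 \<le> q * p\<close> by (intro power_decreasing) auto
    also have "\<dots> \<le> (c / 2) ^ q" using e by (intro power_mono) auto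
    finally have u: "norm (u (q * p)) \<le> (c / 2) ^ q" .
    have "c ^ q * norm (coord v l) \<le> norm (u (q * p)) * C"
      using lower[of q] C(2)[of "u (q * p)"] by (simp add: u_mult)
    also have "\<dots> \<le> (c / 2) ^ q * C" using u C(1) by (intro mult_right_mono) auto
    finally show ?thesis using c by (simp add: power_divide field_simps)
  qed
  moreover obtain q0 where "C / norm (coord v l) < 2 ^ q0"
    using real_arch_pow[of 2] by auto
  moreover have "(2::real) ^ q0 \<le> 2 ^ (q0 + Suc n0)" by (intro power_increasing) auto
  ultimately have "C / norm (coord v l) < 2 ^ (q0 + Suc n0)"
      and "2 ^ (q0 + Suc n0) * norm (coord v l) \<le> C"
    by (linarith, simp only: le_add2)
  with v(2) show False by (simp add: field_simps)
qed

end

section \<open>The common invariant subspace\<close>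

theorem corollary3p4:
  fixes smul :: "'k::{real_normed_field,banach} \<Rightarrow> 'a::banach \<Rightarrow> 'a"
    and x :: "nat \<Rightarrow> 'a"
    and N :: nat
    and a t :: "nat \<Rightarrow> nat \<Rightarrow> nat \<Rightarrow> 'k"
    and A T :: "nat \<Rightarrow> 'a \<Rightarrow> 'a"
  assumes "normed_space_over smul"
    and "schauder_basis smul x"
    and "N \<ge> 1"
    and "\<And>k i j. k \<in> {1..N} \<Longrightarrow> a k i j \<in> \<real>\<^sub>\<ge>\<^sub>0"
    and "\<And>k. k \<in> {1..N} \<Longrightarrow> defines_operator smul x (a k) (A k)"
    and "\<exists>v\<in>basis_cone smul x. v \<noteq> 0 \<and> joint_locally_quasinilpotent_at N A v"
    and "\<And>k. k \<in> {1..N} \<Longrightarrow> defines_operator smul x (t k) (T k)"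
    and "\<And>k i j. k \<in> {1..N} \<Longrightarrow> a k i j = 0 \<Longrightarrow> t k i j = 0"
  shows "\<exists>M. common_nontrivial_closed_invariant_subspace smul N T M"
proof -
  interpret schauder_space smul x
    using assms(1,2) by (simp add: schauder_space_def schauder_space_axioms_def)
  define E where "E = {(j, i). \<exists>k\<in>{1..N}. a k i j \<noteq> 0}"
  from assms(6) obtain v where v: "v \<in> basis_cone smul x" "v \<noteq> 0"
    "joint_locally_quasinilpotent_at N A v" by blast
  obtain l where l: "coord v l \<noteq> 0"
  proof (rule ccontr)
    assume "\<not> thesis"
    then have "(\<lambda>_. 0) sums v" using that coord_sums[of v] by fastforce
    then show False using v(2) sums_unique2[OF _ sums_zero] by blast
  qed
  have "(l, l) \<notin> E\<^sup>+"
    unfolding E_def using no_cycle_through_support[OF assms(5,4) v(1) l v(3)] by blast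
  \<comment> \<open>\<open>Suc l\<close> serves as an arbitrary index different from \<open>l\<close>.\<close>
  then have "(l, Suc l) \<notin> E\<^sup>* \<or> (Suc l, l) \<notin> E\<^sup>*"
    by (metis n_not_Suc_n rtranclD trancl_trans)
  then obtain j m where jm: "(j, m) \<notin> E\<^sup>*" by blast
  define R where "R = E\<^sup>* `` {j}"
  have "common_nontrivial_closed_invariant_subspace smul N T
      {y. \<forall>i. i \<notin> R \<longrightarrow> coord y i = 0}"
  proof (rule support_subspace_invariant[OF assms(7)])
    show "j \<in> R" "m \<notin> R" using jm by (auto simp: R_def)
    fix k i i'
    assume "k \<in> {1..N}" "t k i i' \<noteq> 0" "i' \<in> R"
    then have "(i', i) \<in> E" using assms(8)[of k i i'] unfolding E_def by blast
    with \<open>i' \<in> R\<close> show "i \<in> R" by (auto simp: R_def intro: rtrancl_into_rtrancl)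
  qed
  then show ?thesis by blast
qed

end
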